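(* Let $\mathcal{H}$ be a connected $4$-uniform hypergraph on $m\geq 1$ edges. Then $\chi_{\mathrm{cf}}(\mathcal{H})=\Delta(\mathcal{H})+1$ if and only if $\Delta(\mathcal{H})=1$ or ($\mathcal{H}$ is $2$-regular and $m$ is odd).
   Context: A hypergraph $\mathcal{H}=(V,\mathcal{E})$ consists of a finite nonempty vertex set $V$ and a set $\mathcal{E}$ of nonempty subsets of $V$, called edges or hyperedges. It is $r$-uniform if each edge contains exactly $r$ vertices. The degree of a vertex is the number of edges containing it, the maximum degree $\Delta(\mathcal{H})$ is the largest degree of a vertex, and $\mathcal{H}$ is $a$-regular if each vertex has degree $a$. $\mathcal{H}$ is connected if for any two vertices $u,v$ there is a sequence of vertices starting with $u$ and ending with $v$ such that any two consecutive vertices in this sequence belong to a common hyperedge. A vertex coloring of $\mathcal{H}$ is conflict-free if each edge $E$ contains a vertex whose color is assigned to no other vertex of $E$. The conflict-free chromatic number $\chi_{\mathrm{cf}}(\mathcal{H})$ is the minimum number of colors used in a conflict-free coloring of $\mathcal{H}$. *)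

theory Defs
  imports Main
begin

definition hypergraph :: "'a set \<Rightarrow> 'a set set \<Rightarrow> bool" where
  "hypergraph V \<E> \<longleftrightarrow> finite V \<and> V \<noteq> {} \<and> (\<forall>E\<in>\<E>. E \<noteq> {} \<and> E \<subseteq> V)"

definition uniform_hypergraph :: "nat \<Rightarrow> 'a set set \<Rightarrow> bool" where
  "uniform_hypergraph r \<E> \<longleftrightarrow> (\<forall>E\<in>\<E>. card E = r)"

definition hdegree :: "'a set set \<Rightarrow> 'a \<Rightarrow> nat" where
  "hdegree \<E> v = card {E\<in>\<E>. v \<in> E}"

definition max_hdegree :: "'a set \<Rightarrow> 'a set set \<Rightarrow> nat" where
  "max_hdegree V \<E> = Max (hdegree \<E> ` V)"

definition regular_hypergraph :: "nat \<Rightarrow> 'a set \<Rightarrow> 'a set set \<Rightarrow> bool" where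
  "regular_hypergraph a V \<E> \<longleftrightarrow> (\<forall>v\<in>V. hdegree \<E> v = a)"

definition connected_hypergraph :: "'a set \<Rightarrow> 'a set set \<Rightarrow> bool" where
  "connected_hypergraph V \<E> \<longleftrightarrow>
     (\<forall>u\<in>V. \<forall>v\<in>V. \<exists>p. p \<noteq> [] \<and> set p \<subseteq> V \<and> hd p = u \<and> last p = v \<and>
        successively (\<lambda>x y. \<exists>E\<in>\<E>. x \<in> E \<and> y \<in> E) p)"

definition conflict_free :: "'a set set \<Rightarrow> ('a \<Rightarrow> 'c) \<Rightarrow> bool" where
  "conflict_free \<E> c \<longleftrightarrow> (\<forall>E\<in>\<E>. \<exists>v\<in>E. \<forall>w\<in>E. w \<noteq> v \<longrightarrow> c w \<noteq> c v)"

(* Natural numbers suffice as colors because V is finite. For a hypergraph, an injective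
   coloring is conflict-free, so the minimum is attained. *)
definition cf_chromatic_number :: "'a set \<Rightarrow> 'a set set \<Rightarrow> nat" where
  "cf_chromatic_number V \<E> =
     (LEAST k. \<exists>c :: 'a \<Rightarrow> nat. conflict_free \<E> c \<and> card (c ` V) = k)"

end

theory Submission
  imports Defs
begin

text \<open>
  The proof rests on one property of edges with four vertices: once three of them are colored, at
  most one color of the fourth vertex leaves the edge without a unique color
  (\<open>unique_forbidden_color\<close>). A pattern \<open>aaa\<close> or \<open>bba\<close> on the three vertices forbids
  exactly \<open>a\<close>, and three different colors forbid nothing. So coloring the vertices one after the
  other works as for proper colorings of graphs: a vertex can be colored whenever fewer
  than \<open>k\<close> edges have all their other vertices colored already. Taking a root vertex last and the other
  vertices by decreasing distance to it, each vertex other than the root lies in an edge with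
  another uncolored vertex, so \<open>\<Delta>\<close> colors suffice everywhere except perhaps at the root
  (\<open>greedy_coloring_towards_root\<close>). Hence \<open>\<Delta> + 1\<close> colors always suffice, and \<open>\<Delta>\<close>
  colors suffice if some vertex has degree less than \<open>\<Delta>\<close>. For \<open>\<Delta> = 1\<close> the bound
  \<open>\<Delta> + 1\<close> is attained, since an edge with four vertices needs two colors.

  If \<open>\<Delta> \<ge> 3\<close>, one edge \<open>E\<close> at the root \<open>r\<close> can be neutralized: precolor the three vertices of
  \<open>E - {r}\<close> with different colors, so that \<open>E\<close> forbids nothing at \<open>r\<close>. The greedy
  coloring still reaches every vertex if the hypergraph stays connected when \<open>E - {r}\<close> is
  removed, and such a pair \<open>(E, r)\<close> exists in every connected hypergraph
  (\<open>connected_edge_rest_removable\<close>).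

  If \<open>\<Delta> = 2\<close>, only the \<open>2\<close>-regular case is left, and there the answer depends on a parity. In
  a coloring with \<open>0\<close> and \<open>1\<close>, an edge of size four has a unique color iff it contains an odd
  number of vertices colored \<open>1\<close>. These numbers add up to an even number, since each vertex lies in
  two edges. So the number of good edges is always even, and no such coloring is conflict-free
  if \<open>m\<close> is odd. If \<open>m\<close> is even, the greedy coloring makes all edges but one good, and then
  the last edge is good by parity.
\<close>

section \<open>Unique colors in edges of size four\<close>

definition has_unique_color :: "('a \<Rightarrow> 'c) \<Rightarrow> 'a set \<Rightarrow> bool" where
  "has_unique_color c E \<longleftrightarrow> (\<exists>v\<in>E. \<forall>w\<in>E. w \<noteq> v \<longrightarrow> c w \<noteq> c v)"

lemma conflict_free_iff_has_unique_color:
  "conflict_free \<E> c \<longleftrightarrow> (\<forall>E\<in>\<E>. has_unique_color c E)"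
  by (simp add: conflict_free_def has_unique_color_def)

lemma has_unique_color_cong:
  assumes "\<And>v. v \<in> E \<Longrightarrow> c v = d v"
  shows "has_unique_color c E \<longleftrightarrow> has_unique_color d E"
  using assms by (auto simp: has_unique_color_def)

lemma has_unique_color_fun_upd_other:
  "v \<notin> E \<Longrightarrow> has_unique_color (c(v := i)) E \<longleftrightarrow> has_unique_color c E"
  by (rule has_unique_color_cong) auto

lemma card_4_elems:
  assumes "card E = 4" "v \<in> E"
  obtains x y z where "E = {v, x, y, z}" "distinct [v, x, y, z]"
proof -
  have "card (E - {v}) = Suc (Suc (Suc 0))"
    using assms by simp
  then obtain x y z where xyz: "E - {v} = {x, y, z}" "distinct [x, y, z]"
    by (auto simp: card_Suc_eq)
  then have "E = {v, x, y, z}" "distinct [v, x, y, z]"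
    using assms(2) by auto
  then show ?thesis
    by (rule that)
qed

lemma has_unique_color_4_iff:
  assumes "distinct [v, x, y, z]"
  shows "has_unique_color c {v, x, y, z} \<longleftrightarrow>
    c v \<notin> {c x, c y, c z} \<or> c x \<notin> {c v, c y, c z} \<or>
    c y \<notin> {c v, c x, c z} \<or> c z \<notin> {c v, c x, c y}"
proof -
  have "{v, x, y, z} - {v} = {x, y, z}" "{v, x, y, z} - {x} = {v, y, z}"
    "{v, x, y, z} - {y} = {v, x, z}" "{v, x, y, z} - {z} = {v, x, y}"
    using assms by auto
  moreover have "has_unique_color c E \<longleftrightarrow> (\<exists>v\<in>E. c v \<notin> c ` (E - {v}))" for E
    unfolding has_unique_color_def by (intro bex_cong refl) (simp add: image_iff Ball_def, metis)
  ultimately show ?thesis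
    by simp
qed

text \<open>
  The size four matters here. In an edge of size five, the colors \<open>aabb\<close> of four vertices forbid
  both \<open>a\<close> and \<open>b\<close> for the fifth one.
\<close>

lemma unique_forbidden_color:
  assumes "card E = 4" "v \<in> E"
    and "\<not> has_unique_color (c(v := i)) E" "\<not> has_unique_color (c(v := j)) E"
  shows "i = j"
proof -
  obtain x y z where E: "E = {v, x, y, z}" and d: "distinct [v, x, y, z]"
    by (rule card_4_elems[OF assms(1,2)])
  have forbidden: "c x = c y \<and> k = c z \<or> c x = c z \<and> k = c y \<or> c y = c z \<and> k = c x"
    if "\<not> has_unique_color (c(v := k)) E" for k
    using that d unfolding E has_unique_color_4_iff[OF d] by simp metis
  show ?thesis
    using forbidden[OF assms(3)] forbidden[OF assms(4)] by auto
qed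

text \<open>
  Three different colors can never be spoiled by the fourth vertex, as it repeats at most one of them.
\<close>

lemma rainbow_rest_has_unique_color:
  assumes "card E = 4" "v \<in> E" "inj_on c (E - {v})"
  shows "has_unique_color c E"
proof -
  obtain x y z where E: "E = {v, x, y, z}" and d: "distinct [v, x, y, z]"
    by (rule card_4_elems[OF assms(1,2)])
  have "E - {v} = {x, y, z}"
    using E d by auto
  then have "c x \<noteq> c y" "c x \<noteq> c z" "c y \<noteq> c z"
    using assms(3) d by (auto simp: inj_on_def)
  then show ?thesis
    unfolding E has_unique_color_4_iff[OF d] by auto
qed

text \<open>
  With two colors, a unique color in a set of size four means a split of the form \<open>1 + 3\<close>. This turns
  conflict-freeness into a system of linear equations over the field with two elements.
\<close>

lemma has_unique_color_iff_odd_sum: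
  fixes c :: "'a \<Rightarrow> nat"
  assumes "card E = 4" "c ` E \<subseteq> {0, 1}"
  shows "has_unique_color c E \<longleftrightarrow> odd (\<Sum>v\<in>E. c v)"
proof -
  obtain v where "v \<in> E"
    using assms(1) by fastforce
  then obtain x y z where E: "E = {v, x, y, z}" and d: "distinct [v, x, y, z]"
    using card_4_elems[OF assms(1)] by blast
  have sum: "(\<Sum>v\<in>E. c v) = c v + c x + c y + c z"
    using d by (simp add: E)
  have "c v \<in> {0, 1}" "c x \<in> {0, 1}" "c y \<in> {0, 1}" "c z \<in> {0, 1}"
    using assms(2) by (auto simp: E)
  then show ?thesis
    unfolding sum unfolding E has_unique_color_4_iff[OF d] by (elim insertE emptyE; simp)
qed

lemma free_color_exists:
  assumes fin: "finite F" and F: "\<And>E. E \<in> F \<Longrightarrow> card E = 4 \<and> v \<in> E"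
    and K: "card F < card K"
  obtains i where "i \<in> K" "\<And>E. E \<in> F \<Longrightarrow> has_unique_color (c(v := i)) E"
proof -
  define forb where "forb E = {i. \<not> has_unique_color (c(v := i)) E}" for E
  have "finite (forb E) \<and> card (forb E) \<le> 1" if "E \<in> F" for E
  proof -
    have "i = j" if "i \<in> forb E" "j \<in> forb E" for i j
      using that F[OF \<open>E \<in> F\<close>] unique_forbidden_color[of E v c i j] by (simp add: forb_def)
    then obtain j where "forb E \<subseteq> {j}"
      by blast
    then show ?thesis
      by (auto dest: subset_singletonD)
  qed
  note forb = this
  have "card (\<Union>E\<in>F. forb E) \<le> (\<Sum>E\<in>F. card (forb E))"
    using fin by (rule card_UN_le)
  also have "\<dots> \<le> card F"
    using sum_bounded_above[of F "\<lambda>E. card (forb E)" 1] forb by simp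
  also have "\<dots> < card K"
    by (rule K)
  finally have "card (\<Union>E\<in>F. forb E) < card K" .
  moreover have "finite (\<Union>E\<in>F. forb E)"
    using fin forb by blast
  ultimately have "\<not> K \<subseteq> (\<Union>E\<in>F. forb E)"
    using card_mono not_less by blast
  then obtain i where "i \<in> K" "i \<notin> (\<Union>E\<in>F. forb E)"
    by blast
  then show ?thesis
    using that unfolding forb_def by blast
qed

section \<open>Vertex sets connected to a root\<close>

text \<open>
  Connectedness inside \<open>U\<close> refers to the traces of the edges on \<open>U\<close>: the edge used to add a vertex
  may also have vertices outside. Reading the insertions backwards gives an order that colors the
  root last, in which every other vertex lies in an edge with a vertex that is colored later.
\<close>

inductive grown_from :: "'a set set \<Rightarrow> 'a \<Rightarrow> 'a set \<Rightarrow> bool" for \<E> r where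
  root: "grown_from \<E> r {r}"
| grow: "grown_from \<E> r U \<Longrightarrow> w \<notin> U \<Longrightarrow> E \<in> \<E> \<Longrightarrow> w \<in> E \<Longrightarrow> E \<inter> U \<noteq> {} \<Longrightarrow>
    grown_from \<E> r (insert w U)"

lemma grown_from_root_in: "grown_from \<E> r U \<Longrightarrow> r \<in> U"
  by (induction rule: grown_from.induct) auto

text \<open>
  The new vertex \<open>x\<close> first reaches the old root \<open>r\<close> through \<open>E\<close>. From then on the old
  insertions can be repeated.
\<close>

lemma grown_from_new_root:
  assumes "grown_from \<E> r U" "E \<in> \<E>" "r \<in> E" "x \<in> E" "x \<notin> U"
  shows "grown_from \<E> x (insert x U)"
  using assms(1,5)
proof (induction rule: grown_from.induct)
  case root
  have "grown_from \<E> x (insert r {x})"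
    by (rule grown_from.grow[OF grown_from.root _ assms(2)]) (use root assms(3,4) in auto)
  then show ?case
    by (simp add: insert_commute)
next
  case (grow U w G)
  have "grown_from \<E> x (insert w (insert x U))"
    by (rule grown_from.grow[OF grow.IH _ grow.hyps(3)]) (use grow in auto)
  then show ?case
    by (simp add: insert_commute)
qed

lemma connected_hypergraph_crossing_edge:
  assumes "connected_hypergraph V \<E>" "hypergraph V \<E>" "A \<subseteq> V" "A \<noteq> {}" "A \<noteq> V"
  obtains F where "F \<in> \<E>" "F \<inter> A \<noteq> {}" "\<not> F \<subseteq> A"
proof -
  obtain u v where uv: "u \<in> A" "u \<in> V" "v \<in> V" "v \<notin> A"
    using assms(3-5) by blast
  obtain p where p: "p \<noteq> []" "hd p \<in> A" "last p \<notin> A"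
    "successively (\<lambda>x y. \<exists>E\<in>\<E>. x \<in> E \<and> y \<in> E) p"
    using assms(1)[unfolded connected_hypergraph_def, rule_format, OF uv(2,3)] uv(1,4) by auto
  then have "\<exists>F\<in>\<E>. F \<inter> A \<noteq> {} \<and> \<not> F \<subseteq> A"
  proof (induction p)
    case (Cons a p)
    show ?case
    proof (cases p)
      case (Cons b q)
      with Cons.prems Cons.IH show ?thesis
        by (cases "b \<in> A") auto
    qed (use Cons.prems in auto)
  qed simp
  then show ?thesis
    using that by blast
qed

text \<open>
  A largest set grown from \<open>r\<close> is crossed by no edge, so in a connected hypergraph it is everything.
\<close>

lemma connected_grown_from_vertex_set:
  assumes "connected_hypergraph V \<E>" "hypergraph V \<E>" "r \<in> V"
  shows "grown_from \<E> r V"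
proof -
  let ?P = "\<lambda>U. grown_from \<E> r U \<and> U \<subseteq> V"
  have finV: "finite V"
    using assms(2) by (simp add: hypergraph_def)
  have "?P {r}"
    using assms(3) by (simp add: grown_from.root)
  moreover have "\<forall>U. ?P U \<longrightarrow> card U < Suc (card V)"
    using finV by (auto simp: less_Suc_eq_le card_mono)
  ultimately obtain U where U: "?P U" and max: "\<And>U'. ?P U' \<Longrightarrow> card U' \<le> card U"
    using ex_has_greatest_nat[of ?P "{r}" card "Suc (card V)"] by blast
  have "U = V"
  proof (rule ccontr)
    assume "U \<noteq> V"
    then obtain F where F: "F \<in> \<E>" "F \<inter> U \<noteq> {}" "\<not> F \<subseteq> U"
      using connected_hypergraph_crossing_edge[OF assms(1,2), of U] U grown_from_root_in
      by (metis empty_iff)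
    then obtain w where w: "w \<in> F" "w \<notin> U"
      by blast
    then have "?P (insert w U)"
      using U F assms(2) grown_from.grow[of \<E> r U w F] by (auto simp: hypergraph_def)
    moreover have "finite U"
      using U finV finite_subset by blast
    ultimately show False
      using max[of "insert w U"] w by simp
  qed
  with U show ?thesis
    by simp
qed

text \<open>
  Choose \<open>(E, r, U)\<close> with \<open>U\<close> as large as possible. By maximality no edge leads from \<open>U\<close> to a
  vertex outside \<open>U \<union> E\<close>. If such vertices exist, some edge \<open>F\<close> leads to them from \<open>E - {r}\<close>
  and is disjoint from \<open>U\<close>. For \<open>x \<in> E \<inter> F\<close>, the set \<open>insert x U\<close> is connected to
  the new root \<open>x\<close> by means of \<open>E\<close> and meets \<open>F\<close> only in \<open>x\<close>. So \<open>(F, x, insert x U)\<close>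
  contradicts the maximality.
\<close>

lemma connected_edge_rest_removable:
  assumes "connected_hypergraph V \<E>" "hypergraph V \<E>" "\<E> \<noteq> {}"
  obtains E r U where "E \<in> \<E>" "r \<in> E" "grown_from \<E> r U" "U \<inter> E = {r}" "U \<union> E = V"
proof -
  let ?P = "\<lambda>U. \<exists>E\<in>\<E>. \<exists>r. grown_from \<E> r U \<and> U \<subseteq> V \<and> U \<inter> E = {r}"
  have finV: "finite V" and sub: "\<And>E. E \<in> \<E> \<Longrightarrow> E \<noteq> {} \<and> E \<subseteq> V"
    using assms(2) by (auto simp: hypergraph_def)
  obtain E0 r0 where E0: "E0 \<in> \<E>" "r0 \<in> E0"
    using assms(3) sub by blast
  have start: "?P {r0}"
    using E0 sub by (intro bexI[OF _ E0(1)] exI[of _ r0]) (auto simp: grown_from.root)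
  have bound: "\<forall>U. ?P U \<longrightarrow> card U < Suc (card V)"
    using finV by (auto simp: less_Suc_eq_le card_mono)
  obtain U where "?P U" and max: "\<And>U'. ?P U' \<Longrightarrow> card U' \<le> card U"
    using ex_has_greatest_nat[OF start bound] by (elim exE conjE) simp
  then obtain E r where E: "E \<in> \<E>" and U: "grown_from \<E> r U" "U \<subseteq> V" "U \<inter> E = {r}"
    by blast
  have finU: "finite U"
    using U(2) finV finite_subset by blast
  have closed: "F \<subseteq> U \<union> E" if F: "F \<in> \<E>" "F \<inter> U \<noteq> {}" for F
  proof
    fix w assume w: "w \<in> F"
    show "w \<in> U \<union> E"
    proof (rule ccontr)
      assume nw: "w \<notin> U \<union> E"
      then have "?P (insert w U)"
        using E U w F sub grown_from.grow[of \<E> r U w F]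
        by (intro bexI[OF _ E] exI[of _ r]) auto
      from max[OF this] nw finU show False
        by simp
    qed
  qed
  have "U \<union> E = V"
  proof (rule ccontr)
    assume neq: "U \<union> E \<noteq> V"
    have "U \<union> E \<subseteq> V" "U \<union> E \<noteq> {}"
      using U(2) sub[OF E] by auto
    then obtain F where F: "F \<in> \<E>" "F \<inter> (U \<union> E) \<noteq> {}" "\<not> F \<subseteq> U \<union> E"
      by (rule connected_hypergraph_crossing_edge[OF assms(1,2) _ _ neq])
    then have FU: "F \<inter> U = {}"
      using closed by blast
    then obtain x where x: "x \<in> F" "x \<in> E" "x \<notin> U"
      using F(2) by blast
    have "r \<in> E"
      using U(3) by blast
    then have "?P (insert x U)"
      using grown_from_new_root[OF U(1) E _ x(2,3)] FU x U(2) sub[OF E]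
      by (intro bexI[OF _ F(1)] exI[of _ x]) auto
    from max[OF this] x finU show False
      by simp
  qed
  then show ?thesis
    using that E U by blast
qed

section \<open>Greedy coloring\<close>

text \<open>
  The colors of \<open>c\<close> outside \<open>U\<close> are a precoloring that is extended to \<open>U\<close>. The root is the only
  vertex where all incident edges have their other vertices colored already. This is why one
  may have to give up some edges \<open>X\<close>, which the applications handle by other means.
\<close>

lemma greedy_coloring_towards_root:
  assumes "grown_from \<E> r U"
    and fin: "finite \<E>" and unif: "uniform_hypergraph 4 \<E>"
    and deg: "\<And>v. v \<in> U \<Longrightarrow> hdegree \<E> v \<le> card K"
    and root: "card {E \<in> \<E> - X. r \<in> E} < card K"
    and start: "\<And>E. E \<in> \<E> \<Longrightarrow> E \<inter> U = {} \<Longrightarrow> has_unique_color c E"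
  shows "\<exists>d. (\<forall>v. v \<notin> U \<longrightarrow> d v = c v) \<and> (\<forall>v\<in>U. d v \<in> K) \<and>
    (\<forall>E\<in>\<E> - X. has_unique_color d E)"
  using assms(1) deg start
proof (induction arbitrary: c rule: grown_from.induct)
  case root
  have "finite {E \<in> \<E> - X. r \<in> E}"
    using fin by simp
  then obtain i where i: "i \<in> K"
    "\<And>E. E \<in> {E \<in> \<E> - X. r \<in> E} \<Longrightarrow> has_unique_color (c(r := i)) E"
    by (rule free_color_exists[of _ r K c])
      (use unif assms(5) in \<open>auto simp: uniform_hypergraph_def\<close>)
  have "has_unique_color (c(r := i)) E" if "E \<in> \<E> - X" for E
    using that i(2)[of E] root.prems(2)[of E]
    by (cases "r \<in> E") (auto simp: has_unique_color_fun_upd_other)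
  with i(1) show ?case
    by (intro exI[of _ "c(r := i)"]) (simp del: fun_upd_apply, simp)
next
  case (grow U w G)
  \<comment> \<open>The vertex added last is colored first. The edge \<open>G\<close> that attaches it to \<open>U\<close> still has an
    uncolored vertex and imposes no condition yet.\<close>
  let ?F = "{E \<in> \<E>. w \<in> E \<and> E \<inter> U = {}}"
  have "card ?F < hdegree \<E> w"
    unfolding hdegree_def using fin grow.hyps by (intro psubset_card_mono) auto
  also have "\<dots> \<le> card K"
    using grow.prems(1) by simp
  finally have lt: "card ?F < card K" .
  have "finite ?F"
    using fin by simp
  then obtain i where i: "i \<in> K"
    "\<And>E. E \<in> ?F \<Longrightarrow> has_unique_color (c(w := i)) E"
    by (rule free_color_exists[of ?F w K c, OF _ _ lt])
      (use unif in \<open>auto simp: uniform_hypergraph_def\<close>)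
  have "has_unique_color (c(w := i)) E" if "E \<in> \<E>" "E \<inter> U = {}" for E
    using that i(2)[of E] grow.prems(2)[of E]
    by (cases "w \<in> E") (auto simp: has_unique_color_fun_upd_other)
  then obtain d where d:
    "\<forall>v. v \<notin> U \<longrightarrow> d v = (c(w := i)) v" "\<forall>v\<in>U. d v \<in> K" "\<forall>E\<in>\<E> - X. has_unique_color d E"
    using grow.IH[of "c(w := i)"] grow.prems(1) by (auto simp del: fun_upd_apply)
  with i(1) grow.hyps(2) show ?case
    by (intro exI[of _ d]) auto
qed

section \<open>Bounds in terms of the maximum degree\<close>

lemma cf_chromatic_number_le:
  assumes "conflict_free \<E> c" "c ` V \<subseteq> {..<k}"
  shows "cf_chromatic_number V \<E> \<le> k"
proof -
  have "cf_chromatic_number V \<E> \<le> card (c ` V)"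
    unfolding cf_chromatic_number_def by (rule Least_le) (use assms(1) in blast)
  also have "\<dots> \<le> k"
    using card_mono[OF _ assms(2)] by simp
  finally show ?thesis .
qed

lemma cf_chromatic_number_witness:
  assumes "conflict_free \<E> (c0 :: 'a \<Rightarrow> nat)"
  obtains c :: "'a \<Rightarrow> nat" where "conflict_free \<E> c" "card (c ` V) = cf_chromatic_number V \<E>"
proof -
  have "\<exists>c :: 'a \<Rightarrow> nat. conflict_free \<E> c \<and> card (c ` V) = cf_chromatic_number V \<E>"
    unfolding cf_chromatic_number_def by (rule LeastI_ex) (use assms in blast)
  then show ?thesis
    using that by blast
qed

locale connected_4_uniform =
  fixes V :: "'a set" and \<E> :: "'a set set"
  assumes hyp: "hypergraph V \<E>" and conn: "connected_hypergraph V \<E>"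
    and unif: "uniform_hypergraph 4 \<E>" and nonempty: "\<E> \<noteq> {}"
begin

abbreviation "\<Delta> \<equiv> max_hdegree V \<E>"

lemma finite_V: "finite V" and V_nonempty: "V \<noteq> {}"
  and edge_subset: "E \<in> \<E> \<Longrightarrow> E \<subseteq> V" and card_edge: "E \<in> \<E> \<Longrightarrow> card E = 4"
  using hyp unif by (auto simp: hypergraph_def uniform_hypergraph_def)

lemma finite_edges: "finite \<E>"
  using edge_subset finite_V by (intro finite_subset[of \<E> "Pow V"]) auto

lemma finite_edge: "E \<in> \<E> \<Longrightarrow> finite E"
  using edge_subset finite_V finite_subset by blast

lemma hdegree_le_max: "v \<in> V \<Longrightarrow> hdegree \<E> v \<le> \<Delta>"
  using finite_V by (simp add: max_hdegree_def)

lemma max_hdegree_pos: "\<Delta> \<ge> 1"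
proof -
  obtain E where E: "E \<in> \<E>"
    using nonempty by blast
  then obtain v where v: "v \<in> E"
    using card_edge by fastforce
  have "{E \<in> \<E>. v \<in> E} \<noteq> {}" "finite {E \<in> \<E>. v \<in> E}"
    using E v finite_edges by auto
  then have "hdegree \<E> v \<noteq> 0"
    by (simp add: hdegree_def)
  then show ?thesis
    using hdegree_le_max[of v] E v edge_subset by fastforce
qed

lemma cf_le_if_root_degree_less:
  assumes "r \<in> V" "hdegree \<E> r < k" "\<Delta> \<le> k"
  shows "cf_chromatic_number V \<E> \<le> k"
proof -
  have "\<exists>d. (\<forall>v. v \<notin> V \<longrightarrow> d v = (0::nat)) \<and> (\<forall>v\<in>V. d v \<in> {..<k}) \<and>
    (\<forall>E\<in>\<E> - {}. has_unique_color d E)"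
  proof (rule greedy_coloring_towards_root[OF connected_grown_from_vertex_set[OF conn hyp assms(1)]
        finite_edges unif])
    show "hdegree \<E> v \<le> card {..<k}" if "v \<in> V" for v
      using hdegree_le_max[OF that] assms(3) by simp
    show "card {E \<in> \<E> - {}. r \<in> E} < card {..<k}"
      using assms(2) by (simp add: hdegree_def)
    show "has_unique_color (\<lambda>_. 0) E" if "E \<in> \<E>" "E \<inter> V = {}" for E
      using that edge_subset[of E] card_edge[of E] by (simp add: inf_absorb1)
  qed
  then show ?thesis
    by (auto intro!: cf_chromatic_number_le simp: conflict_free_iff_has_unique_color)
qed

lemma cf_le_max_hdegree_plus_1: "cf_chromatic_number V \<E> \<le> \<Delta> + 1"
proof -
  obtain r where "r \<in> V"
    using V_nonempty by blast
  then show ?thesis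
    using hdegree_le_max[of r] by (intro cf_le_if_root_degree_less[of r]) auto
qed

text \<open>
  Three colors are needed to make \<open>E - {r}\<close> rainbow. The edge \<open>E\<close> is then good for every color of
  \<open>r\<close>, and at most \<open>\<Delta> - 1\<close> edges restrict the color of \<open>r\<close>.
\<close>

lemma cf_le_max_hdegree:
  assumes "\<Delta> \<ge> 3"
  shows "cf_chromatic_number V \<E> \<le> \<Delta>"
proof -
  obtain E r U where E: "E \<in> \<E>" "r \<in> E" and U: "grown_from \<E> r U" "U \<inter> E = {r}" "U \<union> E = V"
    by (rule connected_edge_rest_removable[OF conn hyp nonempty])
  have rest: "finite (E - {r})" "card (E - {r}) = 3"
    using E card_edge finite_edge by auto
  then obtain c where "bij_betw c (E - {r}) {0..<3::nat}"
    using ex_bij_betw_finite_nat[of "E - {r}"] by auto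
  then have c: "inj_on c (E - {r})" "c ` (E - {r}) = {0..<3}"
    by (auto simp: bij_betw_def)
  have "\<exists>d. (\<forall>v. v \<notin> U \<longrightarrow> d v = c v) \<and> (\<forall>v\<in>U. d v \<in> {..<\<Delta>}) \<and>
    (\<forall>F\<in>\<E> - {E}. has_unique_color d F)"
  proof (rule greedy_coloring_towards_root[OF U(1) finite_edges unif])
    show "hdegree \<E> v \<le> card {..<\<Delta>}" if "v \<in> U" for v
      using that U(3) hdegree_le_max[of v] by auto
    have "card {F \<in> \<E> - {E}. r \<in> F} < hdegree \<E> r"
      unfolding hdegree_def using finite_edges E by (intro psubset_card_mono) auto
    also have "\<dots> \<le> \<Delta>"
      using E edge_subset by (auto intro: hdegree_le_max)
    finally show "card {F \<in> \<E> - {E}. r \<in> F} < card {..<\<Delta>}"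
      by simp
    show "has_unique_color c F" if "F \<in> \<E>" "F \<inter> U = {}" for F
    proof -
      have "F \<subseteq> E - {r}"
        using that edge_subset[of F] U by blast
      then have "card F \<le> 3"
        using card_mono[OF rest(1)] rest(2) by metis
      then show ?thesis
        using card_edge that by fastforce
    qed
  qed
  then obtain d where d: "\<And>v. v \<notin> U \<Longrightarrow> d v = c v" "\<And>v. v \<in> U \<Longrightarrow> d v < \<Delta>"
    "\<And>F. F \<in> \<E> \<Longrightarrow> F \<noteq> E \<Longrightarrow> has_unique_color d F"
    by auto
  have dc: "d v = c v" if "v \<in> E - {r}" for v
    using d(1)[of v] U(2) that by blast
  have "inj_on d (E - {r})"
    using c(1) dc by (simp add: inj_on_def)
  then have "has_unique_color d E"
    using E card_edge by (intro rainbow_rest_has_unique_color[of E r])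
  then have "conflict_free \<E> d"
    using d(3) by (auto simp: conflict_free_iff_has_unique_color)
  moreover have "d ` V \<subseteq> {..<\<Delta>}"
  proof
    fix i assume "i \<in> d ` V"
    then obtain v where v: "v \<in> V" "i = d v"
      by blast
    show "i \<in> {..<\<Delta>}"
    proof (cases "v \<in> U")
      case False
      then have "v \<in> E - {r}"
        using v U by blast
      then have "d v \<in> {0..<3}"
        using dc c(2) by auto
      then show ?thesis
        using assms v by simp
    qed (use v d(2) in auto)
  qed
  ultimately show ?thesis
    by (rule cf_chromatic_number_le)
qed

section \<open>Parity in 2-regular hypergraphs\<close>

lemma sum_edge_sums:
  fixes c :: "'a \<Rightarrow> nat"
  shows "(\<Sum>E\<in>\<E>. \<Sum>v\<in>E. c v) = (\<Sum>v\<in>V. hdegree \<E> v * c v)"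
proof -
  have "(\<Sum>E\<in>\<E>. \<Sum>v\<in>E. c v) = (\<Sum>E\<in>\<E>. \<Sum>v\<in>{v \<in> V. v \<in> E}. c v)"
    using edge_subset by (intro sum.cong refl) auto
  also have "\<dots> = (\<Sum>v\<in>V. \<Sum>E\<in>{E \<in> \<E>. v \<in> E}. c v)"
    by (rule sum.swap_restrict[OF finite_edges finite_V])
  finally show ?thesis
    by (simp add: hdegree_def)
qed

text \<open>
  The good edges are those with an odd color sum, and all color sums together count each vertex
  twice.
\<close>

lemma even_card_good_edges:
  fixes c :: "'a \<Rightarrow> nat"
  assumes "regular_hypergraph 2 V \<E>" "c ` V \<subseteq> {0, 1}"
  shows "even (card {E \<in> \<E>. has_unique_color c E})"
proof -
  have "has_unique_color c E \<longleftrightarrow> odd (\<Sum>v\<in>E. c v)" if "E \<in> \<E>" for E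
    using image_mono[OF edge_subset[OF that], of c] assms(2)
    by (rule has_unique_color_iff_odd_sum[OF card_edge[OF that] order_trans])
  then have "{E \<in> \<E>. has_unique_color c E} = {E \<in> \<E>. odd (\<Sum>v\<in>E. c v)}"
    by auto
  moreover have "even (\<Sum>E\<in>\<E>. \<Sum>v\<in>E. c v)"
    using assms(1) by (auto simp: sum_edge_sums regular_hypergraph_def intro!: dvd_sum)
  ultimately show ?thesis
    using even_sum_iff[OF finite_edges] by metis
qed

lemma max_hdegree_if_regular:
  assumes "regular_hypergraph a V \<E>"
  shows "\<Delta> = a"
proof -
  have "hdegree \<E> ` V = {a}"
    using assms V_nonempty by (auto simp: regular_hypergraph_def)
  then show ?thesis
    by (simp add: max_hdegree_def)
qed

text \<open>
  Giving up one edge at the root, two colors suffice for the greedy coloring. The edge that was given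
  up cannot be the only bad edge, since then the number of good edges would be odd.
\<close>

lemma cf_le_2_if_2_regular_even:
  assumes reg: "regular_hypergraph 2 V \<E>" and even: "even (card \<E>)"
  shows "cf_chromatic_number V \<E> \<le> 2"
proof -
  obtain E where E: "E \<in> \<E>"
    using nonempty by blast
  then obtain r where r: "r \<in> E"
    using card_edge by fastforce
  then have rV: "r \<in> V"
    using E edge_subset by blast
  have deg: "hdegree \<E> v = 2" if "v \<in> V" for v
    using reg that by (simp add: regular_hypergraph_def)
  have "\<exists>d. (\<forall>v. v \<notin> V \<longrightarrow> d v = (0::nat)) \<and> (\<forall>v\<in>V. d v \<in> {0, 1}) \<and>
    (\<forall>F\<in>\<E> - {E}. has_unique_color d F)"
  proof (rule greedy_coloring_towards_root[OF connected_grown_from_vertex_set[OF conn hyp rV]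
        finite_edges unif])
    show "hdegree \<E> v \<le> card {0::nat, 1}" if "v \<in> V" for v
      using deg[OF that] by simp
    have "card {F \<in> \<E> - {E}. r \<in> F} < hdegree \<E> r"
      unfolding hdegree_def using finite_edges E r by (intro psubset_card_mono) auto
    then show "card {F \<in> \<E> - {E}. r \<in> F} < card {0::nat, 1}"
      using deg[OF rV] by simp
    show "has_unique_color (\<lambda>_. 0) F" if "F \<in> \<E>" "F \<inter> V = {}" for F
      using that edge_subset[of F] card_edge[of F] by (simp add: inf_absorb1)
  qed
  then obtain d where d: "d ` V \<subseteq> {0, 1::nat}" "\<forall>F\<in>\<E> - {E}. has_unique_color d F"
    unfolding image_subset_iff by blast
  have "has_unique_color d E"
  proof (rule ccontr)
    assume "\<not> has_unique_color d E"
    then have "{F \<in> \<E>. has_unique_color d F} = \<E> - {E}"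
      using d(2) by auto
    then have "Suc (card {F \<in> \<E>. has_unique_color d F}) = card \<E>"
      using E finite_edges by (simp only: card_Suc_Diff1)
    then show False
      using even_card_good_edges[OF reg d(1)] even by (metis even_Suc)
  qed
  then have "conflict_free \<E> d"
    using d(2) by (auto simp: conflict_free_iff_has_unique_color)
  moreover have "d ` V \<subseteq> {..<2}"
    using d(1) by auto
  ultimately show ?thesis
    by (rule cf_chromatic_number_le)
qed

lemma even_card_edges_if_two_colors:
  fixes c :: "'a \<Rightarrow> 'c"
  assumes reg: "regular_hypergraph 2 V \<E>" and cf: "conflict_free \<E> c" and two: "card (c ` V) \<le> 2"
  shows "even (card \<E>)"
proof -
  obtain v0 where v0: "v0 \<in> V"
    using V_nonempty by blast
  \<comment> \<open>Rename the at most two colors to \<open>0\<close> and \<open>1\<close>.\<close>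
  define b where "b v = (if c v = c v0 then 0 else 1 :: nat)" for v
  have "card (c ` V - {c v0}) \<le> Suc 0"
    using v0 two finite_V by simp
  moreover have "finite (c ` V - {c v0})"
    using finite_V by simp
  ultimately have others_agree: "\<forall>i\<in>c ` V - {c v0}. \<forall>j\<in>c ` V - {c v0}. i = j"
    by (simp only: card_le_Suc0_iff_eq)
  have same: "c v = c w" if "v \<in> V" "w \<in> V" "b v = b w" for v w
  proof (cases "c v = c v0")
    case True
    then show ?thesis
      using that(3) by (simp add: b_def split: if_splits)
  next
    case False
    then have "c w \<noteq> c v0"
      using that(3) by (simp add: b_def split: if_splits)
    with False show ?thesis
      using others_agree that(1,2) by blast
  qed
  have "has_unique_color b E" if "E \<in> \<E>" for E
  proof -
    obtain v where v: "v \<in> E" "\<And>w. w \<in> E \<Longrightarrow> w \<noteq> v \<Longrightarrow> c w \<noteq> c v"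
      using cf[unfolded conflict_free_def, rule_format, OF \<open>E \<in> \<E>\<close>] by auto
    then have "b w \<noteq> b v" if "w \<in> E" "w \<noteq> v" for w
      using that v(2)[OF that] same[of w v] v(1) edge_subset[OF \<open>E \<in> \<E>\<close>] by auto
    with v(1) show ?thesis
      unfolding has_unique_color_def by blast
  qed
  then have "{E \<in> \<E>. has_unique_color b E} = \<E>"
    by blast
  moreover have "b ` V \<subseteq> {0, 1}"
    by (auto simp: b_def)
  ultimately show ?thesis
    using even_card_good_edges[OF reg, of b] by simp
qed

lemma card_colors_ge_2:
  assumes "conflict_free \<E> c"
  shows "card (c ` V) \<ge> 2"
proof -
  obtain E where E: "E \<in> \<E>"
    using nonempty by blast
  obtain v where v: "v \<in> E" "\<And>w. w \<in> E \<Longrightarrow> w \<noteq> v \<Longrightarrow> c w \<noteq> c v"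
    using assms[unfolded conflict_free_def, rule_format, OF E] by auto
  obtain w where w: "w \<in> E" "w \<noteq> v"
    using card_4_elems[OF card_edge[OF E] v(1)] by auto
  have "{c v, c w} \<subseteq> c ` V"
    using v w E edge_subset by blast
  then have "card {c v, c w} \<le> card (c ` V)"
    using finite_V by (intro card_mono) auto
  moreover have "card {c v, c w} = 2"
    using v(2)[OF w] by simp
  ultimately show ?thesis
    by simp
qed

lemma conflict_free_witness:
  obtains c :: "'a \<Rightarrow> nat" where "conflict_free \<E> c" "card (c ` V) = cf_chromatic_number V \<E>"
proof -
  obtain f :: "'a \<Rightarrow> nat" where f: "inj_on f V"
    using finite_imp_inj_to_nat_seg[OF finite_V] by blast
  have "conflict_free \<E> f"
    unfolding conflict_free_def
  proof
    fix E assume E: "E \<in> \<E>"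
    then obtain v where v: "v \<in> E"
      using card_edge by fastforce
    have "f w \<noteq> f v" if "w \<in> E" "w \<noteq> v" for w
      using that v inj_onD[OF f, of w v] edge_subset[OF E] by blast
    with v show "\<exists>v\<in>E. \<forall>w\<in>E. w \<noteq> v \<longrightarrow> f w \<noteq> f v"
      by blast
  qed
  then show ?thesis
    using cf_chromatic_number_witness[of \<E> f V] that by blast
qed

section \<open>The characterization\<close>

lemma cf_eq_max_hdegree_plus_1_iff:
  "cf_chromatic_number V \<E> = \<Delta> + 1 \<longleftrightarrow>
    \<Delta> = 1 \<or> (regular_hypergraph 2 V \<E> \<and> odd (card \<E>))"
proof
  assume eq: "cf_chromatic_number V \<E> = \<Delta> + 1"
  show "\<Delta> = 1 \<or> (regular_hypergraph 2 V \<E> \<and> odd (card \<E>))"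
  proof (cases "\<Delta> = 1")
    case False
    have "\<Delta> = 2"
      using cf_le_max_hdegree max_hdegree_pos False eq by fastforce
    have reg: "regular_hypergraph 2 V \<E>"
      unfolding regular_hypergraph_def
    proof
      fix v assume "v \<in> V"
      then show "hdegree \<E> v = 2"
        using cf_le_if_root_degree_less[of v 2] hdegree_le_max[of v] eq \<open>\<Delta> = 2\<close> by fastforce
    qed
    moreover have "odd (card \<E>)"
      using cf_le_2_if_2_regular_even[OF reg] eq \<open>\<Delta> = 2\<close> by fastforce
    ultimately show ?thesis
      by blast
  qed simp
next
  assume "\<Delta> = 1 \<or> (regular_hypergraph 2 V \<E> \<and> odd (card \<E>))"
  moreover obtain c :: "'a \<Rightarrow> nat"
    where c: "conflict_free \<E> c" "card (c ` V) = cf_chromatic_number V \<E>"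
    by (rule conflict_free_witness)
  ultimately have "\<Delta> + 1 \<le> cf_chromatic_number V \<E>"
    using card_colors_ge_2[OF c(1)] even_card_edges_if_two_colors[OF _ c(1)]
      max_hdegree_if_regular[of 2] by fastforce
  then show "cf_chromatic_number V \<E> = \<Delta> + 1"
    using cf_le_max_hdegree_plus_1 by simp
qed

end

theorem theorem7:
  fixes V :: "'a set" and \<E> :: "'a set set" and m :: nat
  assumes "hypergraph V \<E>"
    and "connected_hypergraph V \<E>"
    and "uniform_hypergraph 4 \<E>"
    and "card \<E> = m"
    and "m \<ge> 1"
  shows "cf_chromatic_number V \<E> = max_hdegree V \<E> + 1 \<longleftrightarrow>
    max_hdegree V \<E> = 1 \<or> (regular_hypergraph 2 V \<E> \<and> odd m)"
proof -
  interpret connected_4_uniform V \<E>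
    by unfold_locales (use assms in auto)
  show ?thesis
    using cf_eq_max_hdegree_plus_1_iff assms(4) by simp
qed

end
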